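(* Let $f_{\theta,\alpha}:\mathbb{R}^n\to\mathbb{R}^n$ be a Learned Proximal Network (LPN) with strong convexity modulus $\alpha\in(0,1)$. For any $\lambda\in(0,1)$, define $$f_{\theta,\alpha}^{(\lambda)}\coloneqq(1-\lambda)I_n+\lambda f_{\theta,\alpha},$$ where $I_n$ is the identity map of $\mathbb{R}^n$. Then $f_{\theta,\alpha}^{(\lambda)}$ is an LPN with strong convexity modulus $\alpha_\lambda\coloneqq 1-\lambda(1-\alpha)$.
   Context: ICNN: An input convex neural network is a function $\psi_\theta:\mathbb{R}^n\to\mathbb{R}$, $\psi_\theta(x)\coloneqq z_K$, where $z_{i+1}\coloneqq\sigma(W_iz_i+H_ix+b_i)$ for $i=0,\dots,K-1$, with $W_0,z_0\equiv 0$; here $H_i,W_i$ are linear maps (of compatible dimensions, $z_K$ scalar), each $W_i$ has non-negative entries, $b_i$ are bias vectors, and the activation $\sigma:\mathbb{R}\to\mathbb{R}$ is convex and non-decreasing, applied element-wise. (Different ICNNs may use different activations $\sigma$.) LPN: A map $f:\mathbb{R}^n\to\mathbb{R}^n$ is an LPN with strong convexity modulus $\alpha$ if $0<\alpha<1$ and there is an ICNN $\psi_\theta$ with a Lipschitz activation $\sigma$ such that $f(y)\in\partial\psi_\theta(y)+\alpha y$ for all $y\in\mathbb{R}^n$, where $\partial$ is the convex subdifferential. *)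

theory Defs
  imports "HOL-Analysis.Analysis"
begin

text \<open>
  Layer widths vary with the layer, so hidden vectors and weight matrices are indexed by natural
  numbers: layer \<open>i\<close> has the coordinates \<open>j < d i\<close>, and \<open>W i j k\<close> is the \<open>(j, k)\<close> entry of \<open>W\<^sub>i\<close>.
  The linear map \<open>H\<^sub>i\<close> is given by its rows \<open>H i j\<close>. Values at indices outside these ranges
  never contribute.
\<close>

fun icnn_layer ::
  "(real \<Rightarrow> real) \<Rightarrow> (nat \<Rightarrow> nat) \<Rightarrow> (nat \<Rightarrow> nat \<Rightarrow> nat \<Rightarrow> real) \<Rightarrow>
   (nat \<Rightarrow> nat \<Rightarrow> real ^ 'n) \<Rightarrow> (nat \<Rightarrow> nat \<Rightarrow> real) \<Rightarrow> real ^ 'n \<Rightarrow> nat \<Rightarrow> nat \<Rightarrow> real"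
where
  "icnn_layer \<sigma> d W H b x 0 j = 0"
| "icnn_layer \<sigma> d W H b x (Suc i) j =
     \<sigma> ((\<Sum>k<d i. W i j k * icnn_layer \<sigma> d W H b x i k) + H i j \<bullet> x + b i j)"

definition is_icnn :: "(real \<Rightarrow> real) \<Rightarrow> (real ^ 'n \<Rightarrow> real) \<Rightarrow> bool" where
  "is_icnn \<sigma> \<psi> \<longleftrightarrow>
     convex_on UNIV \<sigma> \<and> mono \<sigma> \<and>
     (\<exists>K d W H b.
        K \<ge> 1 \<and> (\<forall>i\<le>K. d i \<ge> 1) \<and> d K = 1 \<and>
        (\<forall>j<d 1. \<forall>k<d 0. W 0 j k = 0) \<and>
        (\<forall>i<K. \<forall>j<d (Suc i). \<forall>k<d i. W i j k \<ge> 0) \<and>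
        (\<forall>x. \<psi> x = icnn_layer \<sigma> d W H b x K 0))"

definition subdifferential :: "('a::real_inner \<Rightarrow> real) \<Rightarrow> 'a \<Rightarrow> 'a set" where
  "subdifferential g x = {v. \<forall>y. g y \<ge> g x + v \<bullet> (y - x)}"

definition is_lpn :: "real \<Rightarrow> (real ^ 'n \<Rightarrow> real ^ 'n) \<Rightarrow> bool" where
  "is_lpn \<alpha> f \<longleftrightarrow>
     0 < \<alpha> \<and> \<alpha> < 1 \<and>
     (\<exists>\<sigma> \<psi>. is_icnn \<sigma> \<psi> \<and> (\<exists>L. L-lipschitz_on UNIV \<sigma>) \<and>
        (\<forall>y. f y \<in> (\<lambda>v. v + \<alpha> *\<^sub>R y) ` subdifferential \<psi> y))"

end

theory Submission
  imports Defs
begin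

text \<open>
  If \<open>f y = v + \<alpha> y\<close> with \<open>v \<in> \<partial>\<psi>(y)\<close>, the averaged map sends \<open>y\<close> to \<open>lam v + (1 - lam (1 - \<alpha>)) y\<close>, and
  \<open>lam v \<in> \<partial>(lam \<psi>)(y)\<close>. The function \<open>lam \<psi>\<close> is again an ICNN: replacing the activation \<open>\<sigma>\<close>
  by \<open>lam \<sigma>\<close> and every weight \<open>W\<^sub>i\<close> by \<open>W\<^sub>i / lam\<close> multiplies the output of each layer by \<open>lam\<close>.
\<close>

text \<open>By induction the factor \<open>c\<close> carried by layer \<open>i\<close> cancels
  against the \<open>1/c\<close> in the weights, so the argument of \<open>\<sigma>\<close> is
  unchanged, with \<open>H\<close> and \<open>b\<close> kept as they are, and only the outer factor
  \<open>c\<close> remains. Layer 0 vanishes on both sides.\<close>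

lemma icnn_layer_scale:
  assumes "c \<noteq> 0"
  shows "icnn_layer (\<lambda>t. c * \<sigma> t) d (\<lambda>i j k. W i j k / c) H b x i j =
    c * icnn_layer \<sigma> d W H b x i j"
proof (induction i arbitrary: j)
  case (Suc i)
  then show ?case using assms by simp
qed simp

text \<open>Positivity of \<open>c\<close> keeps the activation convex and monotone and the divided
  weights non-negative.\<close>

lemma is_icnn_scale:
  assumes "is_icnn \<sigma> \<psi>" and "c > 0"
  shows "is_icnn (\<lambda>t. c * \<sigma> t) (\<lambda>x. c * \<psi> x)"
proof -
  obtain K d W H b where net:
      "K \<ge> 1" "\<forall>i\<le>K. d i \<ge> 1" "d K = 1"
      "\<forall>j<d 1. \<forall>k<d 0. W 0 j k = 0"
      "\<forall>i<K. \<forall>j<d (Suc i). \<forall>k<d i. W i j k \<ge> 0"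
      "\<forall>x. \<psi> x = icnn_layer \<sigma> d W H b x K 0"
    and \<sigma>: "convex_on UNIV \<sigma>" "mono \<sigma>"
    using assms(1) unfolding is_icnn_def by (elim conjE exE) (rule that)
  have "convex_on UNIV (\<lambda>t. c * \<sigma> t)"
    using \<sigma>(1) assms(2) by (intro convex_on_cmul) auto
  moreover have "mono (\<lambda>t. c * \<sigma> t)"
    using monoD[OF \<sigma>(2)] assms(2) by (intro monoI mult_left_mono) simp_all
  moreover have "\<forall>x. c * \<psi> x =
      icnn_layer (\<lambda>t. c * \<sigma> t) d (\<lambda>i j k. W i j k / c) H b x K 0"
    using net(6) assms(2) by (simp add: icnn_layer_scale)
  moreover have "\<forall>j<d 1. \<forall>k<d 0. W 0 j k / c = 0"
    using net(4) by simp
  moreover have "\<forall>i<K. \<forall>j<d (Suc i). \<forall>k<d i. W i j k / c \<ge> 0"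
    using net(5) assms(2) by simp
  ultimately show ?thesis
    unfolding is_icnn_def using net(1-3)
    by (intro conjI exI[of _ K] exI[of _ d] exI[of _ "\<lambda>i j k. W i j k / c"]
        exI[of _ H] exI[of _ b]) assumption+
qed

lemma subdifferential_scale:
  assumes "v \<in> subdifferential g x" and "c \<ge> 0"
  shows "c *\<^sub>R v \<in> subdifferential (\<lambda>x. c * g x) x"
proof -
  have "c * (g x + v \<bullet> (y - x)) \<le> c * g y" for y
    using assms by (intro mult_left_mono) (auto simp: subdifferential_def)
  then show ?thesis
    by (simp add: subdifferential_def distrib_left)
qed

theorem proposition4p5:
  fixes f :: "real ^ 'n \<Rightarrow> real ^ 'n" and \<alpha> lam :: real
  assumes "is_lpn \<alpha> f"
    and "0 < lam" and "lam < 1"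
  shows "is_lpn (1 - lam * (1 - \<alpha>)) (\<lambda>y. (1 - lam) *\<^sub>R y + lam *\<^sub>R f y)"
proof -
  obtain \<sigma> \<psi> L where \<alpha>: "0 < \<alpha>" "\<alpha> < 1"
    and icnn: "is_icnn \<sigma> \<psi>" and lip: "L-lipschitz_on UNIV \<sigma>"
    and sub: "\<And>y. f y \<in> (\<lambda>v. v + \<alpha> *\<^sub>R y) ` subdifferential \<psi> y"
    using assms(1) unfolding is_lpn_def by blast
  \<comment> \<open>The bound is written \<open>1 * 1\<close> so that the factors can be compared
    one by one.\<close>
  have "lam * (1 - \<alpha>) < 1 * 1"
    using \<alpha> assms(2,3) by (intro mult_strict_mono) auto
  then have "0 < 1 - lam * (1 - \<alpha>)" by simp
  moreover have "1 - lam * (1 - \<alpha>) < 1"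
    using \<alpha> assms(2) by simp
  moreover have "is_icnn (\<lambda>t. lam * \<sigma> t) (\<lambda>x. lam * \<psi> x)"
    using icnn assms(2) by (rule is_icnn_scale)
  moreover have "(\<bar>lam\<bar> * L)-lipschitz_on UNIV (\<lambda>t. lam * \<sigma> t)"
    using lip by (rule lipschitz_on_cmult_real)
  moreover have "(1 - lam) *\<^sub>R y + lam *\<^sub>R f y \<in>
      (\<lambda>v. v + (1 - lam * (1 - \<alpha>)) *\<^sub>R y) ` subdifferential (\<lambda>x. lam * \<psi> x) y" for y
  proof -
    obtain v where v: "v \<in> subdifferential \<psi> y" and fy: "f y = v + \<alpha> *\<^sub>R y"
      using sub by blast
    show ?thesis
    proof (rule image_eqI)
      show "lam *\<^sub>R v \<in> subdifferential (\<lambda>x. lam * \<psi> x) y"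
        using v assms(2) by (simp add: subdifferential_scale)
      \<comment> \<open>The coefficients of \<open>y\<close> add up to
        \<open>(1 - lam) + lam * \<alpha>\<close>, which is the new modulus.\<close>
      show "(1 - lam) *\<^sub>R y + lam *\<^sub>R f y = lam *\<^sub>R v + (1 - lam * (1 - \<alpha>)) *\<^sub>R y"
        by (simp add: fy algebra_simps)
    qed
  qed
  ultimately show ?thesis
    unfolding is_lpn_def
    by (intro conjI exI[of _ "\<lambda>t. lam * \<sigma> t"] exI[of _ "\<lambda>x. lam * \<psi> x"]
        exI[of _ "\<bar>lam\<bar> * L"] allI)
qed

end
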